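(* The ERI space $(X_0,\tau_{\mathrm{ERI}})$ is not a sequential space.
   Context: Let $\overline{\mathbb{R}}=[-\infty,+\infty]$ be the extended real line with its order topology. Let $\sim$ be the equivalence relation on $\overline{\mathbb{R}}$ whose only non-singleton class is $\{-\infty,0,+\infty\}$, let $X_0=\overline{\mathbb{R}}/{\sim}$ be the quotient set, $q\colon\overline{\mathbb{R}}\to X_0$ the projection, and $\ast=q(-\infty)=q(0)=q(+\infty)$. The ERI topology $\tau_{\mathrm{ERI}}$ on $X_0$ consists of all $U\subseteq X_0$ such that (a) $q^{-1}(U)$ is open in $\overline{\mathbb{R}}$, and (b) if $\ast\in U$ then $q^{-1}(U)$ is dense in $\overline{\mathbb{R}}$. (This is a topology.) The ERI space is $X=(X_0,\tau_{\mathrm{ERI}})$. A topological space is sequential if every sequentially closed set (a set containing all limits of convergent sequences of its points) is closed. *)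

theory Defs
  imports "HOL-Analysis.Analysis"
begin

definition eri_rel :: "(ereal \<times> ereal) set"
  where "eri_rel = {(x, y). x = y \<or> (x \<in> {-\<infinity>, 0, \<infinity>} \<and> y \<in> {-\<infinity>, 0, \<infinity>})}"

lemma equiv_eri_rel: "equiv UNIV eri_rel"
  by (auto simp: equiv_def refl_on_def sym_def trans_def eri_rel_def)

definition eri_carrier :: "ereal set set"
  where "eri_carrier = UNIV // eri_rel"

definition eri_proj :: "ereal \<Rightarrow> ereal set"
  where "eri_proj x = eri_rel `` {x}"

definition eri_star :: "ereal set"
  where "eri_star = eri_proj 0"

lemma eri_proj_eq_iff: "eri_proj x = eri_proj y \<longleftrightarrow> (x, y) \<in> eri_rel"
  unfolding eri_proj_def using equiv_eri_rel by (simp add: eq_equiv_class_iff)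

lemma range_eri_proj: "range eri_proj = eri_carrier"
  by (auto simp: eri_carrier_def eri_proj_def quotient_def)

lemma eri_star_eq:
  "eri_proj (-\<infinity>) = eri_star" "eri_proj 0 = eri_star" "eri_proj \<infinity> = eri_star"
  by (simp_all add: eri_star_def eri_proj_eq_iff eri_rel_def)

definition eri_open :: "ereal set set \<Rightarrow> bool"
  where "eri_open U \<longleftrightarrow> U \<subseteq> eri_carrier \<and> open (eri_proj -` U) \<and>
    (eri_star \<in> U \<longrightarrow> closure (eri_proj -` U) = UNIV)"

definition eri_topology :: "ereal set topology"
  where "eri_topology = topology eri_open"

lemma istopology_eri_open: "istopology eri_open"
  unfolding istopology_def
proof (intro conjI allI impI)
  fix S T assume S: "eri_open S" and T: "eri_open T"
  have "closure (eri_proj -` (S \<inter> T)) = UNIV" if "eri_star \<in> S \<inter> T"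
  proof -
    have "closure (eri_proj -` S \<inter> eri_proj -` T) = closure (eri_proj -` S)"
      if "open (eri_proj -` S)" "closure (eri_proj -` T) = UNIV"
      using that open_Int_closure_subset[of "eri_proj -` S" "eri_proj -` T"]
      by (metis Int_UNIV_right closure_closure closure_mono inf_le1 subset_antisym)
    then show ?thesis using S T that by (simp add: eri_open_def)
  qed
  then show "eri_open (S \<inter> T)"
    using S T by (auto simp: eri_open_def intro: open_Int)
next
  fix K assume K: "\<forall>S\<in>K. eri_open S"
  have "closure (eri_proj -` \<Union>K) = UNIV" if star: "eri_star \<in> \<Union>K"
  proof -
    obtain S where S: "S \<in> K" "eri_star \<in> S" using star by blast
    then have "closure (eri_proj -` S) = UNIV" using K by (auto simp: eri_open_def)
    moreover have "closure (eri_proj -` S) \<subseteq> closure (eri_proj -` \<Union>K)"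
      using S by (intro closure_mono) auto
    ultimately show ?thesis by auto
  qed
  moreover have "open (eri_proj -` \<Union>K)"
    using K by (auto simp: vimage_Union eri_open_def)
  ultimately show "eri_open (\<Union>K)"
    using K by (auto simp: eri_open_def)
qed

lemma openin_eri_topology: "openin eri_topology = eri_open"
  by (simp add: eri_topology_def istopology_eri_open topology_inverse')

lemma topspace_eri_topology: "topspace eri_topology = eri_carrier"
proof -
  have "eri_proj -` eri_carrier = UNIV" using range_eri_proj by auto
  then have "eri_open eri_carrier" by (simp add: eri_open_def)
  then show ?thesis
    by (auto simp: topspace_def openin_eri_topology eri_open_def)
qed

definition sequentially_closedin :: "'a topology \<Rightarrow> 'a set \<Rightarrow> bool"
  where "sequentially_closedin X S \<longleftrightarrow> S \<subseteq> topspace X \<and>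
    (\<forall>\<sigma> l. range \<sigma> \<subseteq> S \<and> limitin X \<sigma> l sequentially \<longrightarrow> l \<in> S)"

definition sequential_space :: "'a topology \<Rightarrow> bool"
  where "sequential_space X \<longleftrightarrow> (\<forall>S. sequentially_closedin X S \<longrightarrow> closedin X S)"

end

theory Submission
  imports Defs
begin

text \<open>
  The image of the interval \<open>[1, 2]\<close> is sequentially closed but not closed. It is not closed since
  its complement contains the point \<open>*\<close> and has a non-dense preimage. A sequence in \<open>[1, 2]\<close>
  cannot converge to \<open>*\<close>: by compactness it has a subsequence converging to some \<open>x\<close> in \<open>[1, 2]\<close>,
  and the complement of this subsequence together with \<open>x\<close> is open and co-countable, hence a
  neighbourhood of \<open>*\<close> that the sequence leaves infinitely often.
\<close>

text \<open>Away from the collapsed class every class is a singleton, so \<open>A\<close> is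
  saturated.\<close>

lemma vimage_image_eri_proj_disjoint:
  assumes "A \<inter> {-\<infinity>, 0, \<infinity>} = {}"
  shows "eri_proj -` (eri_proj ` A) = A"
  using assms by (auto simp: eri_proj_eq_iff eri_rel_def)

text \<open>\<open>- A\<close> contains the whole collapsed class and all other classes are
  singletons, so \<open>- A\<close> is saturated.\<close>

lemma vimage_image_eri_proj_Compl:
  assumes "A \<inter> {-\<infinity>, 0, \<infinity>} = {}"
  shows "eri_proj -` (eri_proj ` (- A)) = - A"
  using assms by (auto simp: eri_proj_eq_iff eri_rel_def)

text \<open>The image misses \<open>eri_star\<close>, so the density clause holds vacuously.\<close>

lemma eri_open_image_disjoint:
  assumes "open A" and "A \<inter> {-\<infinity>, 0, \<infinity>} = {}"
  shows "eri_open (eri_proj ` A)"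
proof -
  have "eri_star \<notin> eri_proj ` A"
    using assms(2) by (auto simp: eri_star_def eri_proj_eq_iff eri_rel_def)
  then show ?thesis
    using assms by (auto simp: eri_open_def vimage_image_eri_proj_disjoint range_eri_proj[symmetric])
qed

text \<open>Empty interior of \<open>A\<close> is the same as density of \<open>- A\<close>. This
  supplies the neighbourhoods of \<open>eri_star\<close> used below.\<close>

lemma eri_open_image_Compl:
  assumes "closed A" and "interior A = {}" and "A \<inter> {-\<infinity>, 0, \<infinity>} = {}"
  shows "eri_open (eri_proj ` (- A))"
  using assms
  by (auto simp: eri_open_def vimage_image_eri_proj_Compl range_eri_proj[symmetric] closure_complement)

text \<open>An interior point would be a real number; pulling the interior back to the reals then
  gives a ball inside \<open>C\<close>, but balls are uncountable.\<close>

lemma interior_ereal_image_countable: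
  assumes "countable C"
  shows "interior (ereal ` C) = {}"
proof (rule ccontr)
  assume "interior (ereal ` C) \<noteq> {}"
  then obtain c where c: "ereal c \<in> interior (ereal ` C)"
    using interior_subset[of "ereal ` C"] by blast
  let ?W = "ereal -` interior (ereal ` C)"
  have "open ?W"
    by (rule open_vimage[OF open_interior continuous_on_ereal[OF continuous_on_id]])
  then obtain e where "e > 0" and e: "ball c e \<subseteq> ?W"
    using c by (auto elim: openE)
  have "?W \<subseteq> C"
  proof
    fix x assume "x \<in> ?W"
    then have "ereal x \<in> ereal ` C"
      using interior_subset[of "ereal ` C"] by blast
    then show "x \<in> C"
      by auto
  qed
  then have "countable (ball c e)"
    using e assms by (meson countable_subset)
  then show False
    using uncountable_ball[OF \<open>e > 0\<close>] by blast
qed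

lemma compact_ereal_image: "compact K \<Longrightarrow> compact (ereal ` K)"
  by (rule compact_continuous_image[OF continuous_on_ereal[OF continuous_on_id]])

lemma not_limitin_eri_star:
  assumes K: "compact K" "0 \<notin> K" and a: "range a \<subseteq> K"
  shows "\<not> limitin eri_topology (\<lambda>n. eri_proj (ereal (a n))) eri_star sequentially"
proof
  assume lim: "limitin eri_topology (\<lambda>n. eri_proj (ereal (a n))) eri_star sequentially"
  obtain x r where x: "x \<in> K" and r: "strict_mono (r :: nat \<Rightarrow> nat)" and ar: "(a \<circ> r) \<longlonglongrightarrow> x"
    using K(1) a unfolding compact_def by blast
  \<comment> \<open>Adding the limit \<open>x\<close> makes \<open>A\<close> compact, hence closed
    in the extended reals; countability makes its complement dense.\<close>
  define A where "A = ereal ` insert x (range (a \<circ> r))"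
  have disj: "A \<inter> {-\<infinity>, 0, \<infinity>} = {}"
  proof -
    have "insert x (range (a \<circ> r)) \<subseteq> K"
      using a x by auto
    then have "0 \<notin> insert x (range (a \<circ> r))"
      using K(2) by blast
    then show ?thesis
      unfolding A_def by force
  qed
  have "compact A"
    unfolding A_def
    by (intro compact_ereal_image compact_sequence_with_limit[OF ar])
  moreover have "interior A = {}"
    unfolding A_def by (rule interior_ereal_image_countable) auto
  ultimately have "openin eri_topology (eri_proj ` (- A))"
    using disj by (simp add: openin_eri_topology eri_open_image_Compl compact_imp_closed)
  moreover have "eri_star \<in> eri_proj ` (- A)"
    using disj by (auto simp: eri_star_def)
  ultimately have "\<forall>\<^sub>F n in sequentially. ereal (a n) \<in> eri_proj -` (eri_proj ` (- A))"
    using lim by (auto simp: limitin_def)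
  then have "\<forall>\<^sub>F n in sequentially. ereal (a n) \<notin> A"
    by (simp add: vimage_image_eri_proj_Compl[OF disj])
  \<comment> \<open>Eventual avoidance of \<open>A\<close> passes to the subsequence, all of whose
    terms lie in \<open>A\<close>.\<close>
  then have "\<forall>\<^sub>F n in sequentially. ereal (a (r n)) \<notin> A"
    using r by (rule eventually_subseq[rotated])
  then show False
    by (auto simp: A_def)
qed

text \<open>The limit is not \<open>eri_star\<close>, and every other point has small neighbourhoods
  not subject to the density clause, so compactness of \<open>K\<close> suffices to separate it from
  the image.\<close>

lemma sequentially_closedin_eri_compact:
  assumes K: "compact K" "0 \<notin> K"
  shows "sequentially_closedin eri_topology (eri_proj ` ereal ` K)"
  unfolding sequentially_closedin_def
proof (intro conjI allI impI)
  show "eri_proj ` ereal ` K \<subseteq> topspace eri_topology"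
    by (auto simp: topspace_eri_topology range_eri_proj[symmetric])
next
  fix \<sigma> l
  assume "range \<sigma> \<subseteq> eri_proj ` ereal ` K \<and> limitin eri_topology \<sigma> l sequentially"
  then have \<sigma>: "\<And>n. \<exists>x\<in>K. \<sigma> n = eri_proj (ereal x)" and lim: "limitin eri_topology \<sigma> l sequentially"
    by blast+
  from \<sigma> obtain a where aK: "\<And>n. a n \<in> K" and a: "\<And>n. \<sigma> n = eri_proj (ereal (a n))"
    by metis
  have \<sigma>_eq: "\<sigma> = (\<lambda>n. eri_proj (ereal (a n)))"
    using a by blast
  obtain y where y: "l = eri_proj y"
    using limitin_topspace[OF lim] by (auto simp: topspace_eri_topology range_eri_proj[symmetric])
  have "l \<noteq> eri_star"
    using not_limitin_eri_star[OF K, of a] aK lim \<sigma>_eq by blast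
  then have y_special: "y \<notin> {-\<infinity>, 0, \<infinity>}"
    using y eri_star_eq by auto
  show "l \<in> eri_proj ` ereal ` K"
  proof (rule ccontr)
    assume l: "l \<notin> eri_proj ` ereal ` K"
    define B where "B = - (ereal ` K \<union> {-\<infinity>, 0, \<infinity>})"
    have "compact (ereal ` K)"
      using K(1) by (rule compact_ereal_image)
    then have "open B"
      unfolding B_def by (intro open_Compl closed_Un) (auto simp: compact_imp_closed)
    moreover have disj: "B \<inter> {-\<infinity>, 0, \<infinity>} = {}"
      by (auto simp: B_def)
    ultimately have "openin eri_topology (eri_proj ` B)"
      by (simp add: openin_eri_topology eri_open_image_disjoint)
    moreover have "l \<in> eri_proj ` B"
      using l y y_special by (auto simp: B_def)
    ultimately have "\<forall>\<^sub>F n in sequentially. ereal (a n) \<in> eri_proj -` (eri_proj ` B)"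
      using lim by (auto simp: limitin_def a)
    then have "\<forall>\<^sub>F n in sequentially. ereal (a n) \<in> B"
      by (simp add: vimage_image_eri_proj_disjoint[OF disj])
    then show False
      using aK by (auto simp: B_def)
  qed
qed

theorem proposition3p15: "\<not> sequential_space eri_topology"
proof
  assume seq: "sequential_space eri_topology"
  define A where "A = ereal ` {1..2}"
  have disj: "A \<inter> {-\<infinity>, 0, \<infinity>} = {}"
    by (auto simp: A_def zero_ereal_def)
  have "sequentially_closedin eri_topology (eri_proj ` A)"
    unfolding A_def by (rule sequentially_closedin_eri_compact) auto
  then have "eri_open (eri_carrier - eri_proj ` A)"
    using seq
    by (auto simp: sequential_space_def closedin_def openin_eri_topology topspace_eri_topology)
  moreover have vimage: "eri_proj -` (eri_carrier - eri_proj ` A) = - A"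
    unfolding vimage_Diff vimage_image_eri_proj_disjoint[OF disj] range_eri_proj[symmetric]
    by blast
  \<comment> \<open>This brings the density clause into force for the complement, contradicting that
    \<open>A\<close> contains an open interval.\<close>
  moreover have "eri_star \<in> eri_carrier - eri_proj ` A"
    using vimage disj by (auto simp: eri_star_def vimage_def)
  ultimately have "closure (- A) = UNIV"
    unfolding eri_open_def by simp
  then have "interior A = {}"
    by (auto simp: closure_complement)
  moreover have "ereal ` {1<..<2} \<subseteq> interior A"
    unfolding A_def by (intro interior_maximal image_mono open_ereal) auto
  moreover have "ereal (3/2) \<in> ereal ` {1<..<2}"
    by (intro imageI) simp
  ultimately show False
    by blast
qed

end
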